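(* Set $T_*:=\tau_1+\dots+\tau_n$. For all $T\ge T_*$ and $q\in[1,+\infty)$, we have $$\operatorname{Ran}E_q(T)=\operatorname{Ran}E_q(T_* ).$$ In particular, the difference equation (D) is $L^q$-approximately (respectively, $L^q$-exactly) controllable from the origin if and only if it is $L^q$-approximately (respectively, $L^q$-exactly) controllable in time $T$ for every $T\ge T_*$.
   Context: Difference equation (D). Let $n,m\ge1$ be integers, $\tau_1,\dots,\tau_n>0$, $K$ a real $n\times n$ matrix and $B$ a real $n\times m$ matrix. Equation (D) is $$\begin{pmatrix} y_1(t) \\ \vdots \\ y_n(t) \end{pmatrix}=K\begin{pmatrix} y_1(t-\tau_1) \\ \vdots \\ y_n(t-\tau_n) \end{pmatrix}+Bu(t),\qquad t\ge0.$$ A family $y_i:[-\tau_i,T]\to\mathbb{R}$, $i\in\{1,\dots,n\}$, is a solution of (D) in $[0,T]$ with control $u:[0,T]\to\mathbb{R}^m$ if the equation holds for every $t\in[0,T]$; its initial condition is the family of restrictions $y_i|_{[-\tau_i,0)}$. For every initial condition and control there is a unique solution. For $t\in[0,T]$, $y_{[t]}$ is the family $y_{[t],i}(s)=y_i(t+s)$, $s\in[-\tau_i,0)$. Spaces. $\Sigma^q=\prod_{i=1}^nL^q((-\tau_i,0),\mathbb{R})$ with the product norm. Endpoint operator. Let $\tau=(\tau_1,\dots,\tau_n)$ and $e_1,\dots,e_n$ be the canonical basis of $\mathbb{R}^n$; $\mathbb{N}$ contains $0$, $|\ell|=\ell_1+\dots+\ell_n$. The matrices $\Xi_\ell\in\mathcal{M}_{n,n}(\mathbb{R})$,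 $\ell\in\mathbb{Z}^n$, are defined recursively by $\Xi_\ell=0$ if $\ell\in\mathbb{Z}^n\setminus\mathbb{N}^n$, $\Xi_0=I_n$, and $\Xi_\ell=\sum_{k=1}^nKe_ke_k^T\Xi_{\ell-e_k}$ if $\ell\in\mathbb{N}^n$ and $|\ell|>0$. For $T\ge0$, the bounded linear operator $E_q(T):L^q([0,T],\mathbb{R}^m)\to\Sigma^q$ is given, for $i\in\{1,\dots,n\}$, by $$(E_q(T)u)_i(t)=e_i^T\sum_{\ell\in\mathbb{N}^n,\ \tau\cdot\ell\le T+t}\Xi_\ell Bu(T+t-\tau\cdot\ell),\qquad t\in[-\tau_i,0].$$ $\operatorname{Ran}$ denotes the range. Controllability. (D) is $L^q$-approximately controllable in time $T$ if for every $\epsilon>0$ and $\phi,\psi\in\Sigma^q$ there is $u\in L^q([0,T],\mathbb{R}^m)$ such that the solution $y$ with initial condition $\phi$ and control $u$ satisfies $\|y_{[T]}-\psi\|_{\Sigma^q}<\epsilon$; it is $L^q$-exactly controllable in time $T$ if for every $\phi,\psi\in\Sigma^q$ there is $u\in L^q([0,T],\mathbb{R}^m)$ such that $y_{[T]}=\psi$. (D) is $L^q$-approximately controllable from the origin if for every $\epsilon>0$ and $\psi\in\Sigma^q$ there exist $T_{\epsilon,\psi}>0$ and $u\in L^q([0,T_{\epsilon,\psi}],\mathbb{R}^m)$ such that the solution $y$ with initial condition $0$ and control $u$ satisfies $\|y_{[T_{\epsilon,\psi}]}-\psi\|_{\Sigma^q}<\epsilon$; it is $L^q$-exactly controllable from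 the origin if for every $\psi\in\Sigma^q$ there exist $T_\psi>0$ and $u\in L^q([0,T_\psi],\mathbb{R}^m)$ such that the solution $y$ with initial condition $0$ and control $u$ satisfies $y_{[T_\psi]}=\psi$. *)

theory Defs
  imports "HOL-Analysis.Analysis"
begin

text \<open>
  The index types \<open>'n\<close> (state) and \<open>'m\<close> (control) are finite and nonempty, so \<open>n, m \<ge> 1\<close>.
  A family \<open>(y\<^sub>i)\<close> of real functions, each with its own domain, is a total function
  \<open>y :: 'n \<Rightarrow> real \<Rightarrow> real\<close> whose values off the respective domains are never used.
\<close>

definition Lq_on :: "real \<Rightarrow> real set \<Rightarrow> (real \<Rightarrow> 'a::euclidean_space) set" where
  "Lq_on q S = {f. f \<in> borel_measurable (lebesgue_on S) \<and>
                   integrable (lebesgue_on S) (\<lambda>x. norm (f x) powr q)}"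

definition Lq_norm_on :: "real \<Rightarrow> real set \<Rightarrow> (real \<Rightarrow> 'a::euclidean_space) \<Rightarrow> real" where
  "Lq_norm_on q S f = (LINT x|lebesgue_on S. norm (f x) powr q) powr (1 / q)"

text \<open>
  \<open>Sigma_fun\<close> consists of representatives; the space \<open>\<Sigma>\<^sup>q\<close> itself is the quotient
  \<open>Sigma_fun \<tau> q // Sigma_rel \<tau> q\<close> by componentwise almost everywhere equality.
\<close>

definition Sigma_fun :: "real^'n \<Rightarrow> real \<Rightarrow> ('n::finite \<Rightarrow> real \<Rightarrow> real) set" where
  "Sigma_fun \<tau> q = {x. \<forall>i. x i \<in> Lq_on q {- (\<tau> $ i)<..<0}}"

definition Sigma_eq :: "real^'n \<Rightarrow> ('n::finite \<Rightarrow> real \<Rightarrow> real) \<Rightarrow> ('n \<Rightarrow> real \<Rightarrow> real) \<Rightarrow> bool" where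
  "Sigma_eq \<tau> x y \<longleftrightarrow> (\<forall>i. AE s in lebesgue_on {- (\<tau> $ i)<..<0}. x i s = y i s)"

definition Sigma_rel ::
    "real^'n \<Rightarrow> real \<Rightarrow> (('n::finite \<Rightarrow> real \<Rightarrow> real) \<times> ('n \<Rightarrow> real \<Rightarrow> real)) set" where
  "Sigma_rel \<tau> q = {(x, y). x \<in> Sigma_fun \<tau> q \<and> y \<in> Sigma_fun \<tau> q \<and> Sigma_eq \<tau> x y}"

text \<open>The product norm is taken to be the \<open>\<ell>\<^sup>q\<close> combination of the component norms.\<close>

definition Sigma_norm :: "real^'n \<Rightarrow> real \<Rightarrow> ('n::finite \<Rightarrow> real \<Rightarrow> real) \<Rightarrow> real" where
  "Sigma_norm \<tau> q x =
     (\<Sum>i\<in>UNIV. Lq_norm_on q {- (\<tau> $ i)<..<0} (x i) powr q) powr (1 / q)"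

definition is_solution ::
    "real^'n \<Rightarrow> real^'n^'n \<Rightarrow> real^'m^'n \<Rightarrow> real \<Rightarrow> (real \<Rightarrow> real^'m) \<Rightarrow>
     ('n::finite \<Rightarrow> real \<Rightarrow> real) \<Rightarrow> bool" where
  "is_solution \<tau> K B T u y \<longleftrightarrow>
     (\<forall>t\<in>{0..T}. (\<chi> i. y i t) = K *v (\<chi> i. y i (t - \<tau> $ i)) + B *v u t)"

definition has_initial ::
    "real^'n \<Rightarrow> ('n::finite \<Rightarrow> real \<Rightarrow> real) \<Rightarrow> ('n \<Rightarrow> real \<Rightarrow> real) \<Rightarrow> bool" where
  "has_initial \<tau> \<phi> y \<longleftrightarrow> (\<forall>i. \<forall>s\<in>{- (\<tau> $ i)..<0}. y i s = \<phi> i s)"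

definition segment :: "('n \<Rightarrow> real \<Rightarrow> real) \<Rightarrow> real \<Rightarrow> 'n \<Rightarrow> real \<Rightarrow> real" where
  "segment y t = (\<lambda>i s. y i (t + s))"

function Xi :: "real^'n^'n \<Rightarrow> int^'n \<Rightarrow> real^'n^'n::finite" where
  "Xi K l =
     (if \<exists>i. l $ i < 0 then 0
      else if l = 0 then mat 1
      else \<Sum>k\<in>UNIV.
             K ** (columnvector (axis k 1) :: real^1^'n) ** (rowvector (axis k 1) :: real^'n^1)
               ** Xi K (l - axis k 1))"
  by pat_completeness auto
termination
proof (relation "Wellfounded.measure (\<lambda>(K, l). nat (\<Sum>i\<in>UNIV. l $ i))")
  show "wf (Wellfounded.measure (\<lambda>(K::real^'n^'n, l::int^'n). nat (\<Sum>i\<in>UNIV. l $ i)))"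
    by simp
next
  fix K :: "real^'n^'n" and l :: "int^'n" and k :: 'n
  assume nonneg: "\<not> (\<exists>i. l $ i < 0)" and "l \<noteq> 0"
  then obtain j where "l $ j \<noteq> 0"
    by (auto simp: vec_eq_iff)
  with nonneg have "0 < l $ j"
    by (metis linorder_neqE_linordered_idom)
  moreover have "l $ j \<le> (\<Sum>i\<in>UNIV. l $ i)"
    using nonneg by (intro member_le_sum) (auto simp: not_less)
  moreover have "(\<Sum>i\<in>UNIV. (l - axis k 1) $ i) = (\<Sum>i\<in>UNIV. l $ i) - 1"
    by (simp add: axis_def sum_subtractf)
  ultimately show "((K, l - axis k 1), (K, l)) \<in> Wellfounded.measure (\<lambda>(K, l). nat (\<Sum>i\<in>UNIV. l $ i))"
    by simp
qed

declare Xi.simps [simp del]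

definition delay_dot :: "real^'n \<Rightarrow> int^'n \<Rightarrow> real" where
  "delay_dot \<tau> l = (\<Sum>j\<in>UNIV. \<tau> $ j * of_int (l $ j))"

definition endpoint ::
    "real^'n \<Rightarrow> real^'n^'n \<Rightarrow> real^'m^'n \<Rightarrow> real \<Rightarrow> (real \<Rightarrow> real^'m) \<Rightarrow>
     'n::finite \<Rightarrow> real \<Rightarrow> real" where
  "endpoint \<tau> K B T u = (\<lambda>i t.
     (\<Sum>l\<in>{l. (\<forall>j. 0 \<le> l $ j) \<and> delay_dot \<tau> l \<le> T + t}.
        Xi K l *v (B *v u (T + t - delay_dot \<tau> l))) $ i)"

definition Ran_endpoint ::
    "real^'n \<Rightarrow> real^'n^'n \<Rightarrow> real^'m^'n \<Rightarrow> real \<Rightarrow> real \<Rightarrow>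
     ('n::finite \<Rightarrow> real \<Rightarrow> real) set set" where
  "Ran_endpoint \<tau> K B q T =
     (\<lambda>u. Sigma_rel \<tau> q `` {endpoint \<tau> K B T u}) ` Lq_on q {0..T}"

definition T_star :: "real^'n \<Rightarrow> real" where
  "T_star \<tau> = (\<Sum>i\<in>UNIV. \<tau> $ i)"

text \<open>
  In the definitions below \<open>y\<close> is uniquely determined on the relevant domains by \<open>\<phi>\<close> and \<open>u\<close>, and
  its class modulo \<open>Sigma_rel\<close> does not depend on the representatives chosen for \<open>\<phi>\<close> and \<open>u\<close>.
  Moreover \<open>segment y T\<close> always lies in \<open>Sigma_fun \<tau> q\<close>, so \<open>Sigma_norm\<close> is never applied to a
  non-integrable function (whose Bochner integral would be \<open>0\<close>).
\<close>

definition approx_controllable_in_time ::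
    "real^'n \<Rightarrow> real^'n^'n \<Rightarrow> real^'m^'n::finite \<Rightarrow> real \<Rightarrow> real \<Rightarrow> bool" where
  "approx_controllable_in_time \<tau> K B q T \<longleftrightarrow>
     (\<forall>\<epsilon>>0. \<forall>\<phi>\<in>Sigma_fun \<tau> q. \<forall>\<psi>\<in>Sigma_fun \<tau> q. \<exists>u\<in>Lq_on q {0..T}. \<exists>y.
        is_solution \<tau> K B T u y \<and> has_initial \<tau> \<phi> y \<and>
        Sigma_norm \<tau> q (\<lambda>i s. segment y T i s - \<psi> i s) < \<epsilon>)"

definition exact_controllable_in_time ::
    "real^'n \<Rightarrow> real^'n^'n \<Rightarrow> real^'m^'n::finite \<Rightarrow> real \<Rightarrow> real \<Rightarrow> bool" where
  "exact_controllable_in_time \<tau> K B q T \<longleftrightarrow>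
     (\<forall>\<phi>\<in>Sigma_fun \<tau> q. \<forall>\<psi>\<in>Sigma_fun \<tau> q. \<exists>u\<in>Lq_on q {0..T}. \<exists>y.
        is_solution \<tau> K B T u y \<and> has_initial \<tau> \<phi> y \<and> Sigma_eq \<tau> (segment y T) \<psi>)"

definition approx_controllable_from_origin ::
    "real^'n \<Rightarrow> real^'n^'n \<Rightarrow> real^'m^'n::finite \<Rightarrow> real \<Rightarrow> bool" where
  "approx_controllable_from_origin \<tau> K B q \<longleftrightarrow>
     (\<forall>\<epsilon>>0. \<forall>\<psi>\<in>Sigma_fun \<tau> q. \<exists>T>0. \<exists>u\<in>Lq_on q {0..T}. \<exists>y.
        is_solution \<tau> K B T u y \<and> has_initial \<tau> (\<lambda>i s. 0) y \<and>
        Sigma_norm \<tau> q (\<lambda>i s. segment y T i s - \<psi> i s) < \<epsilon>)"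

definition exact_controllable_from_origin ::
    "real^'n \<Rightarrow> real^'n^'n \<Rightarrow> real^'m^'n::finite \<Rightarrow> real \<Rightarrow> bool" where
  "exact_controllable_from_origin \<tau> K B q \<longleftrightarrow>
     (\<forall>\<psi>\<in>Sigma_fun \<tau> q. \<exists>T>0. \<exists>u\<in>Lq_on q {0..T}. \<exists>y.
        is_solution \<tau> K B T u y \<and> has_initial \<tau> (\<lambda>i s. 0) y \<and> Sigma_eq \<tau> (segment y T) \<psi>)"

end

theory Submission
  imports Defs
begin

text \<open>
  Let \<open>\<sigma>\<^sub>k\<close> be the delay by \<open>\<tau>\<^sub>k\<close>. The trajectory from the origin is
  \<open>(I - K diag(\<sigma>))\<inverse> B u\<close>, and \<open>det (I - K diag(z)) = (\<Sum>S. p\<^sub>S \<Prod>k\<in>S. z\<^sub>k)\<close> with \<open>p\<^sub>\<emptyset> = 1\<close>.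
  Hence the control \<open>g = (\<Sum>S. p\<^sub>S \<Prod>k\<in>S. \<sigma>\<^sub>k) f\<close> produces the trajectory
  \<open>adj (I - K diag(\<sigma>)) B f\<close>. Row \<open>i\<close> of the adjugate is multi-affine and free of \<open>z\<^sub>i\<close>, so it
  delays by at most \<open>T\<^sub>* - \<tau>\<^sub>i\<close>: if \<open>f\<close> lives on \<open>[0, h)\<close>, then component \<open>i\<close> has died out
  by time \<open>T\<^sub>* + h - \<tau>\<^sub>i\<close>. Thus adding \<open>g\<close> to a control \<open>u\<close> on \<open>[0, T + h]\<close>, \<open>T \<ge> T\<^sub>*\<close>, does not
  change the final state, while for \<open>f = - u\<close> on \<open>[0, h)\<close> and \<open>h \<le> min \<tau>\<^sub>k\<close> it makes the control
  vanish on \<open>[0, h)\<close>, so that \<open>[0, h)\<close> can be cut off. Finitely many such cuts lead from \<open>T\<close> to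
  \<open>T\<^sub>*\<close>.
\<close>

subsection \<open>The adjugate of a multi-affine pencil\<close>

text \<open>The determinants with column k replaced by b are the entries of adj(M) b. Cramer's rule
  settles invertible M; continuity gives the rest.\<close>

lemma mult_adjugate:
  fixes M :: "real^'n^'n" and b :: "real^'n"
  shows "(\<Sum>k\<in>UNIV. M $ r $ k * det (\<chi> i j. if j = k then b $ i else M $ i $ j)) = b $ r * det M"
proof -
  let ?adj = "\<lambda>M k. det (\<chi> i j. if j = k then b $ i else M $ i $ j)"
  let ?g = "\<lambda>M. (\<Sum>k\<in>UNIV. M $ r $ k * ?adj M k) - b $ r * det M"
  have inv: "?g A = 0" if "det A \<noteq> 0" for A :: "real^'n^'n"
  proof -
    have "A *v (\<chi> k. ?adj A k / det A) = b"
      by (simp add: cramer[OF that])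
    then have "b $ r = (A *v (\<chi> k. ?adj A k / det A)) $ r"
      by simp
    also have "\<dots> = (\<Sum>k\<in>UNIV. A $ r $ k * ?adj A k) / det A"
      by (simp add: matrix_vector_mult_def sum_divide_distrib)
    finally show ?thesis
      using that by (simp add: field_simps)
  qed
  \<comment> \<open>A singular \<open>M\<close> is a limit of invertible matrices along the segment to the identity.\<close>
  define P where "P t = (\<chi> i j. M $ i $ j + t * (mat 1 $ i $ j - M $ i $ j))" for t
  \<comment> \<open>The determinant is taken over polynomials in t. Since p(1) = det I = 1, p is not
    zero, so \<open>P t\<close> is invertible except for finitely many t, in particular at all t
    near 0 other than 0.\<close>
  define p where "p = det (\<chi> i j. [:M $ i $ j, mat 1 $ i $ j - M $ i $ j:])"
  have p: "poly p t = det (P t)" for t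
    unfolding p_def P_def det_def by (simp add: poly_sum poly_prod of_int_poly)
  have "P 1 = mat 1" "P 0 = M"
    by (simp_all add: P_def vec_eq_iff)
  then have "poly p 1 = 1"
    by (simp add: p)
  then have "p \<noteq> 0"
    by auto
  then have "finite {t. poly p t = 0}"
    by (rule poly_roots_finite)
  then have "eventually (\<lambda>t. t \<notin> {t. poly p t = 0}) (at 0)"
    using islimpt_finite islimpt_iff_eventually by blast
  then have "eventually (\<lambda>t. ?g (P t) = 0) (at 0)"
    by (rule eventually_mono) (use inv p in auto)
  then have "((\<lambda>t. ?g (P t)) \<longlongrightarrow> 0) (at 0)"
    by (rule tendsto_eventually)
  moreover have "continuous_on UNIV (\<lambda>t. ?g (P t))"
  proof -
    have "continuous_on UNIV (\<lambda>t. if j = k then b $ i else P t $ i $ j)" for i j k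
      by (cases "j = k") (auto simp: P_def intro!: continuous_intros)
    moreover have "continuous_on UNIV (\<lambda>t. P t $ i $ j)" for i j
      by (auto simp: P_def intro!: continuous_intros)
    ultimately show ?thesis
      unfolding det_def vec_lambda_beta
      by (intro continuous_on_sum continuous_on_mult continuous_on_prod continuous_on_diff
          continuous_on_const)
  qed
  then have "((\<lambda>t. ?g (P t)) \<longlongrightarrow> ?g (P 0)) (at 0)"
    by (simp add: continuous_on_def)
  ultimately have "?g (P 0) = 0"
    using LIM_unique by blast
  then show ?thesis
    unfolding \<open>P 0 = M\<close> by simp
qed

text \<open>
  \<open>adj (I - K diag(z))\<close> is multi-affine in \<open>z\<close>, and its row \<open>i\<close> does not involve \<open>z\<^sub>i\<close>. \<open>p S\<close> and
  \<open>Q S\<close> are the coefficients of \<open>\<Prod>k\<in>S. z\<^sub>k\<close> in the determinant and the adjugate.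
\<close>

lemma multiaffine_Cayley_Hamilton:
  fixes K :: "real^'n^'n"
  obtains p :: "'n set \<Rightarrow> real" and Q :: "'n set \<Rightarrow> real^'n^'n"
  where "p {} = 1"
    and "\<And>S i j. i \<in> S \<Longrightarrow> Q S $ i $ j = 0"
    and "\<And>S i j. Q S $ i $ j = p S * mat 1 $ i $ j + (\<Sum>k\<in>S. K $ i $ k * Q (S - {k}) $ k $ j)"
proof -
  \<comment> \<open>By multilinearity in the columns, \<open>det (M S)\<close> is the coefficient of
    the product of the z_k, k in S, in det(I - K diag(z)).\<close>
  define M :: "'n set \<Rightarrow> real^'n^'n"
    where "M S = (\<chi> r c. if c \<in> S then - K $ r $ c else mat 1 $ r $ c)" for S
  \<comment> \<open>Entry (i, j) of the adjugate of \<open>M S\<close>: column i is replaced by the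
    unit vector e_j.\<close>
  define C where "C S i j = det (\<chi> r c. if c = i then mat 1 $ r $ j else M S $ r $ c)" for S i j
  define Q :: "'n set \<Rightarrow> real^'n^'n"
    where "Q S = (\<chi> i j. if i \<in> S then 0 else C S i j)" for S
  \<comment> \<open>Column k is overwritten, so membership of k in S is irrelevant to this
    entry.\<close>
  have C: "C (S - {k}) k j = C S k j" for S k j
    unfolding C_def M_def by (rule arg_cong[where f = det]) (auto simp: vec_eq_iff)
  have adj: "(\<Sum>k\<in>UNIV. M S $ i $ k * C S k j) = mat 1 $ i $ j * det (M S)" for S i j
    using mult_adjugate[of "M S" i "\<chi> r. mat 1 $ r $ j"] by (simp add: C_def cong: if_cong)
  have "Q S $ i $ j = det (M S) * mat 1 $ i $ j + (\<Sum>k\<in>S. K $ i $ k * Q (S - {k}) $ k $ j)" for S i j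
  proof -
    \<comment> \<open>Row i of \<open>M S\<close> times its adjugate is split by columns: those in S
      carry - K, the others are unit vectors and leave only k = i, provided i is not in S.\<close>
    have "(\<Sum>k\<in>UNIV. M S $ i $ k * C S k j) =
        (\<Sum>k\<in>S. M S $ i $ k * C S k j) + (\<Sum>k\<in>-S. M S $ i $ k * C S k j)"
      by (subst sum.union_disjoint[symmetric]) (auto intro: sum.cong)
    also have "(\<Sum>k\<in>S. M S $ i $ k * C S k j) = - (\<Sum>k\<in>S. K $ i $ k * Q (S - {k}) $ k $ j)"
      by (simp add: M_def Q_def C sum_negf)
    also have "(\<Sum>k\<in>-S. M S $ i $ k * C S k j) = (\<Sum>k\<in>-S. if k = i then C S i j else 0)"
      by (intro sum.cong) (auto simp: M_def mat_def)
    also have "\<dots> = Q S $ i $ j"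
      by (simp add: Q_def)
    finally have "mat 1 $ i $ j * det (M S) =
        - (\<Sum>k\<in>S. K $ i $ k * Q (S - {k}) $ k $ j) + Q S $ i $ j"
      unfolding adj .
    then show ?thesis
      by (simp add: mult.commute)
  qed
  moreover have "det (M {}) = 1"
    using det_I by (simp add: M_def vec_lambda_eta del: det_I)
  moreover have "Q S $ i $ j = 0" if "i \<in> S" for S i j
    using that by (simp add: Q_def)
  ultimately show thesis
    by (intro that[of "\<lambda>S. det (M S)" Q])
qed

subsection \<open>Functions of class \<open>L\<^sup>q\<close>\<close>

lemma Lq_on_UNIV_iff:
  fixes f :: "real \<Rightarrow> 'a::euclidean_space"
  shows "f \<in> Lq_on q UNIV \<longleftrightarrow>
    f \<in> borel_measurable lebesgue \<and> integrable lebesgue (\<lambda>x. norm (f x) powr q)"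
  by (simp add: Lq_on_def lebesgue_on_UNIV_eq)

text \<open>Extension by zero moves the problem to the whole line, where translations are available.
  It respects the integrand because \<open>0 powr q = 0\<close>.\<close>

lemma Lq_on_iff_extend:
  fixes f :: "real \<Rightarrow> 'a::euclidean_space"
  assumes "S \<in> sets lebesgue"
  shows "f \<in> Lq_on q S \<longleftrightarrow> (\<lambda>x. if x \<in> S then f x else 0) \<in> Lq_on q UNIV"
proof -
  have "(\<lambda>x. indicator S x *\<^sub>R f x) = (\<lambda>x. if x \<in> S then f x else 0)"
    by auto
  moreover have "(\<lambda>x. indicator S x *\<^sub>R norm (f x) powr q) =
      (\<lambda>x. norm (if x \<in> S then f x else 0) powr q)"
    by auto
  ultimately show ?thesis
    using assms
    by (simp add: Lq_on_UNIV_iff Lq_on_def borel_measurable_restrict_space_iff integrable_restrict_space)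
qed

lemma Lq_on_cong:
  assumes "\<And>x. x \<in> S \<Longrightarrow> f x = g x"
  shows "f \<in> Lq_on q S \<longleftrightarrow> g \<in> Lq_on q S"
  unfolding Lq_on_def using assms
  using measurable_cong[of "lebesgue_on S" f g borel]
    Bochner_Integration.integrable_cong[OF refl, of "lebesgue_on S" "\<lambda>x. norm (f x) powr q" "\<lambda>x. norm (g x) powr q"]
  by auto

lemma Lq_on_zero: "(\<lambda>x. 0) \<in> Lq_on q S"
  by (simp add: Lq_on_def)

lemma Lq_on_add:
  fixes f g :: "real \<Rightarrow> 'a::euclidean_space"
  assumes "0 \<le> q" "f \<in> Lq_on q S" "g \<in> Lq_on q S"
  shows "(\<lambda>x. f x + g x) \<in> Lq_on q S"
proof -
  have [measurable]: "f \<in> borel_measurable (lebesgue_on S)" "g \<in> borel_measurable (lebesgue_on S)"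
    using assms by (auto simp: Lq_on_def)
  have bound: "norm (f x + g x) powr q \<le> 2 powr q * norm (f x) powr q + 2 powr q * norm (g x) powr q"
    for x
  proof -
    \<comment> \<open>Comparison with the larger summand replaces convexity and covers every q \<ge>
      0.\<close>
    have "norm (f x + g x) \<le> 2 * max (norm (f x)) (norm (g x))"
      by norm
    then have "norm (f x + g x) powr q \<le> (2 * max (norm (f x)) (norm (g x))) powr q"
      using assms(1) by (intro powr_mono2) auto
    also have "\<dots> \<le> 2 powr q * norm (f x) powr q + 2 powr q * norm (g x) powr q"
      by (auto simp: powr_mult max_def)
    finally show ?thesis .
  qed
  have "integrable (lebesgue_on S) (\<lambda>x. norm (f x + g x) powr q)"
  proof (rule Bochner_Integration.integrable_bound)
    show "integrable (lebesgue_on S)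
        (\<lambda>x. 2 powr q * norm (f x) powr q + 2 powr q * norm (g x) powr q)"
      using assms by (intro Bochner_Integration.integrable_add integrable_mult_right) (auto simp: Lq_on_def)
  qed (use bound in \<open>auto intro!: AE_I2\<close>)
  then show ?thesis
    by (simp add: Lq_on_def)
qed

lemma Lq_on_scaleR:
  fixes f :: "real \<Rightarrow> 'a::euclidean_space"
  assumes "f \<in> Lq_on q S"
  shows "(\<lambda>x. c *\<^sub>R f x) \<in> Lq_on q S"
  using assms by (auto simp: Lq_on_def powr_mult)

lemma Lq_on_sum:
  fixes f :: "'i \<Rightarrow> real \<Rightarrow> 'a::euclidean_space"
  assumes "0 \<le> q" "\<And>i. i \<in> I \<Longrightarrow> f i \<in> Lq_on q S"
  shows "(\<lambda>x. \<Sum>i\<in>I. f i x) \<in> Lq_on q S"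
  using assms(2)
  by (induction I rule: infinite_finite_induct) (auto intro!: Lq_on_add Lq_on_zero assms(1))

lemma Lq_on_diff:
  fixes f g :: "real \<Rightarrow> 'a::euclidean_space"
  assumes "0 \<le> q" "f \<in> Lq_on q S" "g \<in> Lq_on q S"
  shows "(\<lambda>x. f x - g x) \<in> Lq_on q S"
  using Lq_on_add[OF assms(1,2) Lq_on_scaleR[OF assms(3), of "-1"]] by simp

lemma Lq_on_subset:
  fixes f :: "real \<Rightarrow> 'a::euclidean_space"
  assumes "f \<in> Lq_on q S" "T \<subseteq> S" "S \<in> sets lebesgue" "T \<in> sets lebesgue"
  shows "f \<in> Lq_on q T"
proof -
  let ?f = "\<lambda>x. if x \<in> S then f x else 0"
  have "?f \<in> borel_measurable lebesgue" "integrable lebesgue (\<lambda>x. norm (?f x) powr q)"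
    using assms(1,3) by (auto simp: Lq_on_iff_extend[of S] Lq_on_UNIV_iff)
  then have "?f \<in> Lq_on q T"
    using assms(4) integrable_mult_indicator[of T lebesgue "\<lambda>x. norm (?f x) powr q"]
    by (auto simp: Lq_on_def integrable_restrict_space intro: measurable_restrict_space1)
  moreover have "f \<in> Lq_on q T \<longleftrightarrow> ?f \<in> Lq_on q T"
    by (rule Lq_on_cong) (use assms(2) in auto)
  ultimately show ?thesis
    by simp
qed

lemma Lq_on_restrict:
  fixes f :: "real \<Rightarrow> 'a::euclidean_space"
  assumes "f \<in> Lq_on q UNIV" "S \<in> sets lebesgue"
  shows "(\<lambda>x. if x \<in> S then f x else 0) \<in> Lq_on q UNIV"
  using Lq_on_subset[OF assms(1), of S] assms(2) Lq_on_iff_extend[of S f] by simp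

lemma Lq_on_shift:
  fixes f :: "real \<Rightarrow> 'a::euclidean_space"
  assumes "f \<in> Lq_on q UNIV"
  shows "(\<lambda>x. f (x + a)) \<in> Lq_on q UNIV"
  using assms borel_measurable_affine[of f 1 a]
    lebesgue_integrable_real_affine[of "\<lambda>x. norm (f x) powr q" 1 a]
  by (simp add: Lq_on_UNIV_iff add.commute)

subsection \<open>Trajectories from the origin\<close>

text \<open>The Neumann series of the trajectory from the origin, in absolute time, so that
  different horizons can be compared.\<close>

definition response ::
    "real^'n \<Rightarrow> real^'n^'n \<Rightarrow> real^'m^'n \<Rightarrow> (real \<Rightarrow> real^'m) \<Rightarrow> real \<Rightarrow> real^'n::finite" where
  "response \<tau> K B u t =
     (\<Sum>l\<in>{l. (\<forall>j. 0 \<le> l $ j) \<and> delay_dot \<tau> l \<le> t}. Xi K l *v (B *v u (t - delay_dot \<tau> l)))"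

lemma endpoint_eq_response: "endpoint \<tau> K B T u i t = response \<tau> K B u (T + t) $ i"
  by (simp add: endpoint_def response_def)

lemma is_solution_iff:
  "is_solution \<tau> K B T u y \<longleftrightarrow>
     (\<forall>t\<in>{0..T}. \<forall>i. y i t = (\<Sum>j\<in>UNIV. K $ i $ j * y j (t - \<tau> $ j)) + (B *v u t) $ i)"
  by (simp add: is_solution_def vec_eq_iff matrix_vector_mult_def)

lemma Xi_nonneg:
  assumes "Xi K l \<noteq> 0"
  shows "0 \<le> l $ i"
  using assms Xi.simps[of K l] by (metis not_less)

lemma Xi_mult_vec:
  assumes "\<And>j. 0 \<le> l $ j" "l \<noteq> 0"
  shows "(Xi K l *v w) $ i = (\<Sum>k\<in>UNIV. K $ i $ k * (Xi K (l - axis k 1) *v w) $ k)"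
proof -
  \<comment> \<open>The factor e_k e_k^T keeps only coordinate k of v, which then meets column k of
    K.\<close>
  have K: "((K ** (columnvector (axis k 1) :: real^1^'a) ** (rowvector (axis k 1) :: real^'a^1)) *v v) $ i
      = K $ i $ k * v $ k" for k and v :: "real^'a"
    by (simp add: matrix_vector_mult_def matrix_matrix_mult_def columnvector_def rowvector_def
        axis_def mult_delta_left mult_delta_right)
  have sum_mult: "sum A S *v v = (\<Sum>k\<in>S. A k *v v)"
    for A :: "'a \<Rightarrow> real^'a^'a" and S and v :: "real^'a"
    by (induction S rule: infinite_finite_induct) (simp_all add: matrix_vector_mult_add_rdistrib)
  have "Xi K l *v w = (\<Sum>k\<in>UNIV. (K ** (columnvector (axis k 1) :: real^1^'a) **
      (rowvector (axis k 1) :: real^'a^1)) *v (Xi K (l - axis k 1) *v w))"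
    using assms by (subst Xi.simps)
      (auto simp: not_less[symmetric] matrix_vector_mul_assoc sum_mult)
  then show ?thesis
    by (simp add: K)
qed

section \<open>Multi-indices and their total delays\<close>

lemma delay_dot_0: "delay_dot \<tau> 0 = 0"
  by (simp add: delay_dot_def)

lemma delay_dot_add: "delay_dot \<tau> (l + m) = delay_dot \<tau> l + delay_dot \<tau> m"
  by (simp add: delay_dot_def algebra_simps sum.distrib)

lemma delay_dot_axis: "delay_dot \<tau> (axis k 1) = \<tau> $ k"
  by (simp add: delay_dot_def axis_def if_distrib cong: if_cong)

locale delays =
  fixes \<tau> :: "real^'n::finite"
  assumes tau_pos: "0 < \<tau> $ i"
begin

text \<open>h serves as step length for the method of steps: over a time interval of length h, all
  delayed values are already known.\<close>

lemma obtain_min_delay: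
  obtains h where "0 < h" "\<And>i. h \<le> \<tau> $ i"
proof (rule that)
  show "0 < Min (range (($) \<tau>))"
    using tau_pos by simp
qed simp

lemma delay_dot_nonneg: "(\<And>j. 0 \<le> l $ j) \<Longrightarrow> 0 \<le> delay_dot \<tau> l"
  unfolding delay_dot_def using tau_pos by (intro sum_nonneg mult_nonneg_nonneg) (auto simp: less_imp_le)

text \<open>All terms of \<open>delay_dot\<close> are nonnegative, so each l_j is at most t /
  \<tau>_j. Finiteness matters because a sum over an infinite set is 0 by convention.\<close>

lemma finite_delay_dot_le: "finite {l. (\<forall>j. 0 \<le> l $ j) \<and> delay_dot \<tau> l \<le> t}"
proof (rule finite_subset)
  show "finite (vec_lambda ` (\<Pi>\<^sub>E j\<in>UNIV. {0..\<lfloor>t / \<tau> $ j\<rfloor>}))"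
    by (intro finite_imageI finite_PiE) auto
  show "{l. (\<forall>j. 0 \<le> l $ j) \<and> delay_dot \<tau> l \<le> t} \<subseteq> vec_lambda ` (\<Pi>\<^sub>E j\<in>UNIV. {0..\<lfloor>t / \<tau> $ j\<rfloor>})"
  proof
    fix l assume "l \<in> {l. (\<forall>j. 0 \<le> l $ j) \<and> delay_dot \<tau> l \<le> t}"
    then have l: "\<And>j. 0 \<le> l $ j" "delay_dot \<tau> l \<le> t"
      by auto
    have "l $ j \<le> \<lfloor>t / \<tau> $ j\<rfloor>" for j
    proof -
      have "\<tau> $ j * of_int (l $ j) \<le> delay_dot \<tau> l"
        unfolding delay_dot_def using l tau_pos
        by (intro member_le_sum) (auto simp: less_imp_le)
      then show ?thesis
        using l tau_pos[of j] by (simp add: le_floor_iff field_simps)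
    qed
    with l have "($) l \<in> (\<Pi>\<^sub>E j\<in>UNIV. {0..\<lfloor>t / \<tau> $ j\<rfloor>})"
      by auto
    then show "l \<in> vec_lambda ` (\<Pi>\<^sub>E j\<in>UNIV. {0..\<lfloor>t / \<tau> $ j\<rfloor>})"
      by (metis image_eqI vec_nth_inverse)
  qed
qed

section \<open>Causality, linearity and time shifts of the response\<close>

lemma response_neg: "t < 0 \<Longrightarrow> response \<tau> K B u t = 0"
  unfolding response_def using delay_dot_nonneg by (intro sum.neutral) force

lemma response_cong:
  assumes "\<And>s. 0 \<le> s \<Longrightarrow> s \<le> t \<Longrightarrow> u s = v s"
  shows "response \<tau> K B u t = response \<tau> K B v t"
  unfolding response_def by (intro sum.cong refl) (auto simp: assms delay_dot_nonneg)

lemma response_add: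
  "response \<tau> K B (\<lambda>t. u t + v t) t = response \<tau> K B u t + response \<tau> K B v t"
  by (simp add: response_def matrix_vector_right_distrib sum.distrib)

text \<open>Indices with t - a < \<open>delay_dot \<tau> l\<close> \<le> t read the control before
  time a, where it is zero; the others form the index set at time t - a.\<close>

lemma response_delay:
  assumes "0 \<le> a"
  shows "response \<tau> K B (\<lambda>s. if s < a then 0 else u (s - a)) t = response \<tau> K B u (t - a)"
  unfolding response_def
  by (rule sum.mono_neutral_cong_right) (use assms finite_delay_dot_le in \<open>auto simp: algebra_simps\<close>)

text \<open>On nonnegative times the control is the delay by a of its own advance, so
  \<open>response_delay\<close> applies. This is what cuts off an initial interval.\<close>

lemma response_advance:
  assumes "0 \<le> a" "\<And>s. 0 \<le> s \<Longrightarrow> s < a \<Longrightarrow> u s = 0"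
  shows "response \<tau> K B (\<lambda>s. u (s + a)) t = response \<tau> K B u (t + a)"
proof -
  have "response \<tau> K B (\<lambda>s. u (s + a)) t =
      response \<tau> K B (\<lambda>s. if s < a then 0 else u (s - a + a)) (t + a)"
    using response_delay[OF assms(1), of K B "\<lambda>s. u (s + a)" "t + a"] by simp
  also have "\<dots> = response \<tau> K B u (t + a)"
    using assms by (intro response_cong) auto
  finally show ?thesis .
qed

text \<open>Summed over l, the recursion for \<open>Xi\<close> becomes the difference equation: l =
  0 gives B u(t), and passing from l to l - e_k accounts for the delay \<tau>_k.\<close>

lemma response_eq:
  assumes "0 \<le> t"
  shows "response \<tau> K B u t $ i =
    (\<Sum>k\<in>UNIV. K $ i $ k * response \<tau> K B u (t - \<tau> $ k) $ k) + (B *v u t) $ i"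
proof -
  define A where "A t = {l :: int^'n. (\<forall>j. 0 \<le> l $ j) \<and> delay_dot \<tau> l \<le> t}" for t
  define X where "X l s = Xi K l *v (B *v u s)" for l s
  have resp: "response \<tau> K B u t = (\<Sum>l\<in>A t. X l (t - delay_dot \<tau> l))" for t
    by (simp add: response_def A_def X_def)
  have fin: "finite (A t)" for t
    unfolding A_def by (rule finite_delay_dot_le)
  have "0 \<in> A t"
    using assms by (simp add: A_def delay_dot_0)
  have shift: "(\<Sum>l\<in>A t - {0}. X (l - axis k 1) (t - delay_dot \<tau> l) $ k) =
      response \<tau> K B u (t - \<tau> $ k) $ k" for k
  proof -
    \<comment> \<open>Indices with l_k = 0 drop out: l - e_k has a negative entry, where
      \<open>Xi\<close> vanishes.\<close>
    have "(\<Sum>l\<in>A t - {0}. X (l - axis k 1) (t - delay_dot \<tau> l) $ k) =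
        (\<Sum>l\<in>{l \<in> A t. 1 \<le> l $ k}. X (l - axis k 1) (t - delay_dot \<tau> l) $ k)"
    proof (rule sum.mono_neutral_right)
      show "\<forall>l\<in>A t - {0} - {l \<in> A t. 1 \<le> l $ k}. X (l - axis k 1) (t - delay_dot \<tau> l) $ k = 0"
      proof
        fix l assume "l \<in> A t - {0} - {l \<in> A t. 1 \<le> l $ k}"
        then have "\<not> 0 \<le> (l - axis k 1) $ k"
          by (auto simp: axis_def)
        then have "Xi K (l - axis k 1) = 0"
          using Xi_nonneg by blast
        then show "X (l - axis k 1) (t - delay_dot \<tau> l) $ k = 0"
          by (simp add: X_def)
      qed
    qed (use fin in \<open>auto simp: axis_def\<close>)
    also have "\<dots> = (\<Sum>l\<in>A (t - \<tau> $ k). X l (t - \<tau> $ k - delay_dot \<tau> l) $ k)"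
    proof (rule sum.reindex_bij_witness[of _ "\<lambda>l. l + axis k 1" "\<lambda>l. l - axis k 1"])
      fix l assume l: "l \<in> {l \<in> A t. 1 \<le> l $ k}"
      have "delay_dot \<tau> (l - axis k 1) = delay_dot \<tau> l - \<tau> $ k"
        using delay_dot_add[of \<tau> "l - axis k 1" "axis k 1"] by (simp add: delay_dot_axis)
      with l show "l - axis k 1 \<in> A (t - \<tau> $ k)"
        "X (l - axis k 1) (t - \<tau> $ k - delay_dot \<tau> (l - axis k 1)) $ k =
          X (l - axis k 1) (t - delay_dot \<tau> l) $ k"
        by (auto simp: A_def axis_def)
    qed (auto simp: A_def axis_def delay_dot_add delay_dot_axis[unfolded axis_def])
    finally show ?thesis
      by (simp add: resp)
  qed
  have "response \<tau> K B u t $ i = X 0 t $ i + (\<Sum>l\<in>A t - {0}. X l (t - delay_dot \<tau> l) $ i)"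
    by (simp add: resp sum.remove[OF fin \<open>0 \<in> A t\<close>] delay_dot_0)
  also have "(\<Sum>l\<in>A t - {0}. X l (t - delay_dot \<tau> l) $ i) =
      (\<Sum>l\<in>A t - {0}. \<Sum>k\<in>UNIV. K $ i $ k * X (l - axis k 1) (t - delay_dot \<tau> l) $ k)"
    unfolding X_def by (intro sum.cong refl Xi_mult_vec) (auto simp: A_def)
  also have "\<dots> = (\<Sum>k\<in>UNIV. K $ i $ k * (\<Sum>l\<in>A t - {0}. X (l - axis k 1) (t - delay_dot \<tau> l) $ k))"
    by (subst sum.swap) (simp add: sum_distrib_left)
  finally show ?thesis
    unfolding shift by (simp add: X_def Xi.simps[of K 0])
qed

lemma is_solution_response: "is_solution \<tau> K B T u (\<lambda>i t. response \<tau> K B u t $ i)"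
  by (simp add: is_solution_iff response_eq)

text \<open>Method of steps: every delay is at least h, so at times below (n + 1) h the equation
  only reads values before n h.\<close>

lemma solution_unique:
  assumes y: "is_solution \<tau> K B T u y" and z: "is_solution \<tau> K B T u z"
    and initial: "\<And>i s. s \<in> {- (\<tau> $ i)..<0} \<Longrightarrow> y i s = z i s"
    and t: "t \<in> {- (\<tau> $ i)..T}"
  shows "y i t = z i t"
proof -
  obtain h where h: "0 < h" "\<And>i. h \<le> \<tau> $ i"
    using obtain_min_delay by blast
  have "\<forall>i. \<forall>t\<in>{- (\<tau> $ i)..T}. t < real n * h \<longrightarrow> y i t = z i t" for n
  proof (induction n)
    case 0
    then show ?case
      using initial by auto
  next
    case (Suc n)
    show ?case
    proof (intro allI ballI impI)
      fix i t assume t: "t \<in> {- (\<tau> $ i)..T}" "t < real (Suc n) * h"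
      show "y i t = z i t"
      proof (cases "t < 0")
        case True
        then show ?thesis
          using initial t by auto
      next
        case False
        have "y j (t - \<tau> $ j) = z j (t - \<tau> $ j)" for j
          using Suc t False h(2)[of j] h(1) by (auto simp: algebra_simps)
        then show ?thesis
          using y z t False by (simp add: is_solution_iff)
      qed
    qed
  qed
  moreover obtain n :: nat where "t < real n * h"
    using reals_Archimedean3[OF h(1)] by blast
  ultimately show ?thesis
    using t by blast
qed

lemma solution_eq_response:
  assumes "is_solution \<tau> K B T u y" "\<And>i s. s \<in> {- (\<tau> $ i)..<0} \<Longrightarrow> y i s = 0"
    and "t \<in> {- (\<tau> $ i)..T}"
  shows "y i t = response \<tau> K B u t $ i"
  by (rule solution_unique[OF assms(1) is_solution_response]) (use assms(2,3) in \<open>auto simp: response_neg\<close>)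

end

subsection \<open>Changing the horizon\<close>

context delays
begin

lemma T_star_pos: "0 < T_star \<tau>"
  unfolding T_star_def using tau_pos by (intro sum_pos) auto

text \<open>Applying the determinant to f turns the Neumann series into the finite adjugate sum, so
  each component dies out a bounded time after f does.\<close>

lemma annihilated_control:
  fixes K :: "real^'n^'n" and B :: "real^'m^'n"
  assumes h: "0 < h" "\<And>i. h \<le> \<tau> $ i" and T: "T_star \<tau> \<le> T" and f: "\<And>s. s \<notin> {0..<h} \<Longrightarrow> f s = 0"
  obtains p :: "'n set \<Rightarrow> real"
  where "p {} = 1"
    "\<And>i t. t \<in> {T + h - \<tau> $ i..} \<Longrightarrow>
      response \<tau> K B (\<lambda>t. \<Sum>S\<in>UNIV. p S *\<^sub>R f (t - (\<Sum>k\<in>S. \<tau> $ k))) t $ i = 0"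
proof -
  obtain p and Q :: "'n set \<Rightarrow> real^'n^'n" where p: "p {} = 1"
    and Q0: "\<And>S i j. i \<in> S \<Longrightarrow> Q S $ i $ j = 0"
    and Q: "\<And>S i j. Q S $ i $ j = p S * mat 1 $ i $ j + (\<Sum>k\<in>S. K $ i $ k * Q (S - {k}) $ k $ j)"
    using multiaffine_Cayley_Hamilton[of K] by blast
  define \<sigma> where "\<sigma> S = (\<Sum>k\<in>S. \<tau> $ k)" for S
  define g where "g t = (\<Sum>S\<in>UNIV. p S *\<^sub>R f (t - \<sigma> S))" for t
  define b where "b t = B *v f t" for t
  \<comment> \<open>\<open>y\<close> is adj(I - K diag(\<sigma>)) B f; uniqueness will identify it
    with the response to \<open>g\<close>.\<close>
  define y where "y i t = (\<Sum>S\<in>UNIV. (Q S *v b (t - \<sigma> S)) $ i)" for i t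
  have Q0_vec: "(Q S *v w) $ i = 0" if "i \<in> S" for S w i
    using that by (simp add: matrix_vector_mult_def Q0)
  have Q_vec: "(Q S *v w) $ i = p S * w $ i + (\<Sum>k\<in>S. K $ i $ k * (Q (S - {k}) *v w) $ k)" for S w i
  proof -
    have "(Q S *v w) $ i = (\<Sum>j\<in>UNIV. (p S * mat 1 $ i $ j) * w $ j) +
        (\<Sum>j\<in>UNIV. (\<Sum>k\<in>S. K $ i $ k * Q (S - {k}) $ k $ j) * w $ j)"
      by (simp add: matrix_vector_mult_def Q[of S i] distrib_right sum.distrib)
    also have "(\<Sum>j\<in>UNIV. (p S * mat 1 $ i $ j) * w $ j) = p S * w $ i"
      by (simp add: mat_def mult_delta_left mult_delta_right)
    also have "(\<Sum>j\<in>UNIV. (\<Sum>k\<in>S. K $ i $ k * Q (S - {k}) $ k $ j) * w $ j) =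
        (\<Sum>k\<in>S. K $ i $ k * (Q (S - {k}) *v w) $ k)"
      unfolding sum_distrib_right
      by (subst sum.swap) (simp add: matrix_vector_mult_def sum_distrib_left mult.assoc)
    finally show ?thesis .
  qed
  have \<sigma>_nonneg: "0 \<le> \<sigma> S" for S
    unfolding \<sigma>_def using tau_pos by (intro sum_nonneg) (auto simp: less_imp_le)
  have \<sigma>_remove: "\<sigma> S = \<tau> $ k + \<sigma> (S - {k})" if "k \<in> S" for k S
    unfolding \<sigma>_def using that by (simp add: sum.remove)
  have \<sigma>_le: "\<sigma> S + \<tau> $ i \<le> T_star \<tau>" if "i \<notin> S" for i S
  proof -
    have "\<sigma> S \<le> \<sigma> (UNIV - {i})"
      unfolding \<sigma>_def using that tau_pos by (intro sum_mono2) (auto simp: less_imp_le)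
    then show ?thesis
      using \<sigma>_remove[of i UNIV] by (simp add: T_star_def \<sigma>_def)
  qed
  \<comment> \<open>Delaying component k by \<tau>_k turns S into \<open>insert k S\<close>. Sets
    already containing k contribute nothing, since row k of \<open>Q S\<close> is zero; hence no
    delay occurs twice.\<close>
  have delayed: "(\<Sum>S\<in>UNIV. (Q S *v b (t - \<tau> $ k - \<sigma> S)) $ k) =
      (\<Sum>S\<in>{S. k \<in> S}. (Q (S - {k}) *v b (t - \<sigma> S)) $ k)" for k t
  proof -
    have "(\<Sum>S\<in>UNIV. (Q S *v b (t - \<tau> $ k - \<sigma> S)) $ k) =
        (\<Sum>S\<in>{S. k \<notin> S}. (Q S *v b (t - \<tau> $ k - \<sigma> S)) $ k)"
      by (rule sum.mono_neutral_right) (auto simp: Q0_vec)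
    also have "\<dots> = (\<Sum>S\<in>{S. k \<in> S}. (Q (S - {k}) *v b (t - \<sigma> S)) $ k)"
      by (rule sum.reindex_bij_witness[of _ "\<lambda>S. S - {k}" "insert k"])
        (auto simp: \<sigma>_remove[of k "insert k _"] insert_absorb diff_diff_eq)
    finally show ?thesis .
  qed
  \<comment> \<open>After exchanging the sums over S and k, the recursion for \<open>Q\<close> is
    the difference equation driven by \<open>g\<close>.\<close>
  have "is_solution \<tau> K B t g y" for t
    unfolding is_solution_iff
  proof (intro ballI allI)
    fix s i
    have "y i s = (\<Sum>S\<in>UNIV. p S * b (s - \<sigma> S) $ i) +
        (\<Sum>S\<in>UNIV. \<Sum>k\<in>S. K $ i $ k * (Q (S - {k}) *v b (s - \<sigma> S)) $ k)"
      unfolding y_def by (subst Q_vec) (simp add: sum.distrib)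
    also have "(\<Sum>S\<in>UNIV. p S * b (s - \<sigma> S) $ i) = (B *v g s) $ i"
      by (simp add: g_def b_def linear_sum[OF matrix_vector_mul_linear] matrix_vector_mult_scaleR)
    also have "(\<Sum>S\<in>UNIV. \<Sum>k\<in>S. K $ i $ k * (Q (S - {k}) *v b (s - \<sigma> S)) $ k) =
        (\<Sum>k\<in>UNIV. \<Sum>S\<in>{S. k \<in> S}. K $ i $ k * (Q (S - {k}) *v b (s - \<sigma> S)) $ k)"
      using sum.swap_restrict[of UNIV UNIV
          "\<lambda>S k. K $ i $ k * (Q (S - {k}) *v b (s - \<sigma> S)) $ k" "\<lambda>S k. k \<in> S"]
      by simp
    also have "\<dots> = (\<Sum>k\<in>UNIV. K $ i $ k * y k (s - \<tau> $ k))"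
      by (simp add: y_def delayed sum_distrib_left)
    finally show "y i s = (\<Sum>j\<in>UNIV. K $ i $ j * y j (s - \<tau> $ j)) + (B *v g s) $ i"
      by simp
  qed
  moreover have "y i s = 0" if "s < 0" for i s
  proof -
    have "f (s - \<sigma> S) = 0" for S
      using that \<sigma>_nonneg[of S] by (intro f) auto
    then show ?thesis
      by (simp add: y_def b_def)
  qed
  ultimately have y: "y i t = response \<tau> K B g t $ i" if "0 \<le> t" for i t
    using that tau_pos[of i] by (intro solution_eq_response[of K B t]) auto
  have "response \<tau> K B g t $ i = 0" if t: "t \<in> {T + h - \<tau> $ i..}" for t i
  proof (cases "0 \<le> t")
    case True
    have "(Q S *v b (t - \<sigma> S)) $ i = 0" for S
    proof (cases "i \<in> S")
      case False
      \<comment> \<open>For i outside S, \<open>\<sigma> S\<close> \<le> T_* - \<tau>_i, so t -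
        \<open>\<sigma> S\<close> \<ge> h. Equality is harmless because the support of f is
        half-open.\<close>
      have "f (t - \<sigma> S) = 0"
        using t T \<sigma>_le[OF False] by (intro f) auto
      then show ?thesis
        by (simp add: b_def)
    qed (rule Q0_vec)
    then have "y i t = 0"
      by (simp add: y_def)
    with y[OF True] show ?thesis
      by simp
  qed (simp add: response_neg)
  with p show thesis
    unfolding g_def \<sigma>_def by (intro that[of p]) auto
qed

text \<open>A single cut: the correction leaves the final state unchanged and makes the control
  vanish on [0, h), after which time is advanced by h.\<close>

lemma endpoint_step:
  fixes K :: "real^'n^'n" and B :: "real^'m^'n"
  assumes "0 \<le> q" and h: "0 < h" "\<And>i. h \<le> \<tau> $ i" and T: "T_star \<tau> \<le> T"
    and u: "u \<in> Lq_on q {0..T + h}"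
  obtains v where "v \<in> Lq_on q {0..T}"
    "\<And>i t. t \<in> {- (\<tau> $ i)..0} \<Longrightarrow> endpoint \<tau> K B (T + h) u i t = endpoint \<tau> K B T v i t"
proof -
  define f where "f = (\<lambda>t. if t \<in> {0..<h} then - u t else 0)"
  have f: "f s = 0" if "s \<notin> {0..<h}" for s
    unfolding f_def using that by (rule if_not_P)
  obtain p :: "'n set \<Rightarrow> real" where p: "p {} = 1"
    and resp: "\<And>i t. t \<in> {T + h - \<tau> $ i..} \<Longrightarrow>
      response \<tau> K B (\<lambda>t. \<Sum>S\<in>UNIV. p S *\<^sub>R f (t - (\<Sum>k\<in>S. \<tau> $ k))) t $ i = 0"
    using annihilated_control[where K = K and B = B and f = f, OF h T f] by blast
  define w where "w t = u t + (\<Sum>S\<in>UNIV. p S *\<^sub>R f (t - (\<Sum>k\<in>S. \<tau> $ k)))" for t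
  have "T > 0"
    using T T_star_pos by simp
  have "f \<in> Lq_on q UNIV"
    unfolding f_def
  proof (rule Lq_on_iff_extend[THEN iffD1])
    have "{0..<h} \<subseteq> {0..T + h}"
      using \<open>T > 0\<close> by auto
    from Lq_on_subset[OF Lq_on_scaleR[OF u, of "-1"] this]
    show "(\<lambda>t. - u t) \<in> Lq_on q {0..<h}"
      by simp
  qed simp
  then have "(\<lambda>t. f (t - a)) \<in> Lq_on q UNIV" for a
    using Lq_on_shift[of f q "- a"] by simp
  then have "(\<lambda>t. \<Sum>S\<in>UNIV. p S *\<^sub>R f (t - (\<Sum>k\<in>S. \<tau> $ k))) \<in> Lq_on q UNIV"
    by (intro Lq_on_sum Lq_on_scaleR \<open>0 \<le> q\<close>)
  then have w: "w \<in> Lq_on q {0..T + h}"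
    unfolding w_def by (intro Lq_on_add \<open>0 \<le> q\<close> u) (rule Lq_on_subset, auto)
  have w0: "w t = 0" if t: "0 \<le> t" "t < h" for t
  proof -
    \<comment> \<open>For nonempty S the shifted copy of f starts no earlier than h. On [0, h) only
      S = {} contributes, and p {} = 1 gives u - u.\<close>
    have "f (t - (\<Sum>k\<in>S. \<tau> $ k)) = 0" if S: "S \<noteq> {}" for S
    proof -
      obtain k where "k \<in> S"
        using S by blast
      then have "\<tau> $ k \<le> (\<Sum>k\<in>S. \<tau> $ k)"
        using tau_pos by (intro member_le_sum) (auto simp: less_imp_le)
      then show ?thesis
        using t h(2)[of k] by (intro f) auto
    qed
    then have "(\<Sum>S\<in>UNIV. p S *\<^sub>R f (t - (\<Sum>k\<in>S. \<tau> $ k))) = (\<Sum>S\<in>{{}}. p S *\<^sub>R f (t - (\<Sum>k\<in>S. \<tau> $ k)))"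
      by (intro sum.mono_neutral_right) auto
    then show ?thesis
      using t by (simp add: w_def p f_def)
  qed
  show thesis
  proof (rule that)
    show "(\<lambda>t. w (t + h)) \<in> Lq_on q {0..T}"
    proof -
      \<comment> \<open>Outside [0, T + h] nothing is known about \<open>w\<close>, so it is set to
        zero there before translating.\<close>
      let ?w = "\<lambda>t. if t \<in> {0..T + h} then w t else 0"
      have "?w \<in> Lq_on q UNIV"
        using w Lq_on_iff_extend[of "{0..T + h}" w q] by simp
      then have "(\<lambda>t. ?w (t + h)) \<in> Lq_on q {0..T}"
        by (rule Lq_on_subset[OF Lq_on_shift]) auto
      moreover have "(\<lambda>t. w (t + h)) \<in> Lq_on q {0..T} \<longleftrightarrow> (\<lambda>t. ?w (t + h)) \<in> Lq_on q {0..T}"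
        by (rule Lq_on_cong) (use h in auto)
      ultimately show ?thesis by simp
    qed
    have w_eq: "w = (\<lambda>t. u t + (\<Sum>S\<in>UNIV. p S *\<^sub>R f (t - (\<Sum>k\<in>S. \<tau> $ k))))"
      by (simp add: w_def fun_eq_iff)
    fix i t assume "t \<in> {- (\<tau> $ i)..0}"
    \<comment> \<open>Since t \<ge> - \<tau>_i, component i of the correction has died out by time T
      + h + t.\<close>
    then have "response \<tau> K B w (T + h + t) $ i = response \<tau> K B u (T + h + t) $ i"
      using resp[of "T + h + t" i] by (simp add: w_eq response_add)
    moreover have "response \<tau> K B (\<lambda>t. w (t + h)) (T + t) = response \<tau> K B w (T + h + t)"
      using response_advance[of h w K B "T + t"] w0 h by (simp add: add_ac)
    ultimately show "endpoint \<tau> K B (T + h) u i t = endpoint \<tau> K B T (\<lambda>t. w (t + h)) i t"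
      by (simp add: endpoint_eq_response)
  qed
qed

lemma endpoint_shorten:
  fixes K :: "real^'n^'n" and B :: "real^'m^'n"
  assumes "0 \<le> q" and T: "T_star \<tau> \<le> T" and u: "u \<in> Lq_on q {0..T}"
  obtains v where "v \<in> Lq_on q {0..T_star \<tau>}"
    "\<And>i t. t \<in> {- (\<tau> $ i)..0} \<Longrightarrow> endpoint \<tau> K B T u i t = endpoint \<tau> K B (T_star \<tau>) v i t"
proof (cases "T = T_star \<tau>")
  case True
  with u that show thesis by blast
next
  case False
  obtain h0 where h0: "0 < h0" "\<And>i. h0 \<le> \<tau> $ i"
    using obtain_min_delay by blast
  obtain N :: nat where N: "T - T_star \<tau> < real N * h0"
    using reals_Archimedean3[OF h0(1)] by blast
  with T have "N > 0"
    by (cases N) auto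
  \<comment> \<open>N equal cuts, each no longer than the smallest delay, end exactly at
    T_*.\<close>
  define h where "h = (T - T_star \<tau>) / N"
  have "0 < h"
    using False T \<open>N > 0\<close> by (simp add: h_def)
  have "h \<le> h0"
    using N \<open>N > 0\<close> by (simp add: h_def field_simps)
  with h0 have h_le: "h \<le> \<tau> $ i" for i
    using order_trans by blast
  have "\<exists>v\<in>Lq_on q {0..T_star \<tau>}. \<forall>i. \<forall>t\<in>{- (\<tau> $ i)..0}.
      endpoint \<tau> K B (T_star \<tau> + real n * h) u i t = endpoint \<tau> K B (T_star \<tau>) v i t"
    if "u \<in> Lq_on q {0..T_star \<tau> + real n * h}" for n u
    using that
  proof (induction n arbitrary: u)
    case 0
    then show ?case by auto
  next
    case (Suc n)
    have len: "T_star \<tau> + real (Suc n) * h = (T_star \<tau> + real n * h) + h"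
      by (simp add: algebra_simps)
    have le: "T_star \<tau> \<le> T_star \<tau> + real n * h"
      using \<open>0 < h\<close> by simp
    obtain w where w: "w \<in> Lq_on q {0..T_star \<tau> + real n * h}"
      "\<And>i t. t \<in> {- (\<tau> $ i)..0} \<Longrightarrow> endpoint \<tau> K B (T_star \<tau> + real (Suc n) * h) u i t =
        endpoint \<tau> K B (T_star \<tau> + real n * h) w i t"
      unfolding len
      using endpoint_step[where K = K and B = B, OF \<open>0 \<le> q\<close> \<open>0 < h\<close> h_le le Suc.prems[unfolded len]]
      by blast
    obtain v where "v \<in> Lq_on q {0..T_star \<tau>}"
      "\<And>i t. t \<in> {- (\<tau> $ i)..0} \<Longrightarrow> endpoint \<tau> K B (T_star \<tau> + real n * h) w i t =
        endpoint \<tau> K B (T_star \<tau>) v i t"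
      using Suc.IH[OF w(1)] by blast
    with w(2) show ?case
      by (intro bexI[of _ v]) simp_all
  qed
  from this[of u N] have "\<exists>v\<in>Lq_on q {0..T_star \<tau>}. \<forall>i. \<forall>t\<in>{- (\<tau> $ i)..0}.
      endpoint \<tau> K B T u i t = endpoint \<tau> K B (T_star \<tau>) v i t"
    using u \<open>N > 0\<close> by (simp add: h_def)
  with that show thesis by blast
qed

text \<open>From the origin, zero control keeps the system at rest, so u can be preceded by a
  waiting time T - T'.\<close>

lemma endpoint_prolong:
  fixes K :: "real^'n^'n" and B :: "real^'m^'n"
  assumes T: "T' \<le> T" and u: "u \<in> Lq_on q {0..T'}"
  obtains v where "v \<in> Lq_on q {0..T}"
    "\<And>i t. t \<le> 0 \<Longrightarrow> endpoint \<tau> K B T v i t = endpoint \<tau> K B T' u i t"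
proof
  let ?u = "\<lambda>t. if t \<in> {0..T'} then u t else 0"
  let ?v = "\<lambda>s. ?u (s - (T - T'))"
  have "?u \<in> Lq_on q UNIV"
    using u Lq_on_iff_extend[of "{0..T'}" u q] by simp
  from Lq_on_shift[OF this, of "- (T - T')"] have "?v \<in> Lq_on q UNIV"
    by (simp only: add_uminus_conv_diff)
  then show "?v \<in> Lq_on q {0..T}"
    by (rule Lq_on_subset) auto
  fix i and t :: real assume t: "t \<le> 0"
  \<comment> \<open>\<open>?u\<close> is zero at negative times, so \<open>?v\<close> already has
    the form that \<open>response_delay\<close> expects.\<close>
  have v: "?v = (\<lambda>s. if s < T - T' then 0 else ?u (s - (T - T')))"
    by auto
  have "response \<tau> K B ?v (T + t) = response \<tau> K B ?u (T + t - (T - T'))"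
    by (subst v, rule response_delay) (use T in simp)
  also have "T + t - (T - T') = T' + t"
    by simp
  also have "response \<tau> K B ?u (T' + t) = response \<tau> K B u (T' + t)"
    using t by (intro response_cong) auto
  finally show "endpoint \<tau> K B T ?v i t = endpoint \<tau> K B T' u i t"
    by (simp add: endpoint_eq_response)
qed

text \<open>The method of steps as a finite iteration. Each iterate is built from translated and
  truncated L^q functions by linear combination, so integrability of the final segment comes
  along.\<close>

lemma free_solution:
  fixes K :: "real^'n^'n" and B :: "real^'m^'n"
  assumes "0 \<le> q" and \<phi>: "\<phi> \<in> Sigma_fun \<tau> q"
  obtains z where "is_solution \<tau> K B T (\<lambda>_. 0) z" "has_initial \<tau> \<phi> z" "segment z T \<in> Sigma_fun \<tau> q"
proof -
  obtain h where h: "0 < h" "\<And>i. h \<le> \<tau> $ i"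
    using obtain_min_delay by blast
  define \<phi>' where "\<phi>' i t = (if t \<in> {- (\<tau> $ i)..<0} then \<phi> i t else 0)" for i t
  \<comment> \<open>A function fixed by \<open>step\<close> on [0, T] solves the uncontrolled
    equation; the initial data are reinserted in every round.\<close>
  define step where "step Y i t = \<phi>' i t +
      (if t \<in> {0..T} then \<Sum>j\<in>UNIV. K $ i $ j * Y j (t - \<tau> $ j) else 0)" for Y i t
  define Y where "Y n = (step ^^ n) \<phi>'" for n
  have Y_Suc: "Y (Suc n) = step (Y n)" for n
    by (simp add: Y_def)
  have "\<phi>' i \<in> Lq_on q UNIV" for i
  proof -
    \<comment> \<open>The initial condition also prescribes the value at \<open>- \<tau>\<^sub>i\<close>, which \<open>\<phi> \<in> \<Sigma>\<^sup>q\<close> does not see.\<close>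
    have "(\<lambda>t. if t \<in> {- (\<tau> $ i)<..<0} then \<phi> i t else 0) \<in> Lq_on q UNIV"
      using \<phi> Lq_on_iff_extend[of "{- (\<tau> $ i)<..<0}" "\<phi> i" q] by (simp add: Sigma_fun_def)
    moreover have "(\<lambda>t. if t \<in> {- (\<tau> $ i)} then \<phi> i (- (\<tau> $ i)) else 0) \<in> Lq_on q UNIV"
    proof (rule Lq_on_iff_extend[THEN iffD1])
      have "finite_measure (lebesgue_on {- (\<tau> $ i)})"
        by (intro finite_measure_lebesgue_on bounded_set_imp_lmeasurable) auto
      then show "(\<lambda>t. \<phi> i (- (\<tau> $ i))) \<in> Lq_on q {- (\<tau> $ i)}"
        by (simp add: Lq_on_def finite_measure.integrable_const)
    qed simp
    ultimately have "(\<lambda>t. (if t \<in> {- (\<tau> $ i)<..<0} then \<phi> i t else 0) +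
        (if t \<in> {- (\<tau> $ i)} then \<phi> i (- (\<tau> $ i)) else 0)) \<in> Lq_on q UNIV"
      by (rule Lq_on_add[OF \<open>0 \<le> q\<close>])
    also have "(\<lambda>t. (if t \<in> {- (\<tau> $ i)<..<0} then \<phi> i t else 0) +
        (if t \<in> {- (\<tau> $ i)} then \<phi> i (- (\<tau> $ i)) else 0)) = \<phi>' i"
      using tau_pos[of i] by (auto simp: \<phi>'_def)
    finally show ?thesis .
  qed
  note \<phi>' = this
  have Y: "Y n i \<in> Lq_on q UNIV" for n i
  proof (induction n arbitrary: i)
    case 0
    then show ?case
      by (simp add: Y_def \<phi>')
  next
    case (Suc n)
    have "(\<lambda>t. K $ i $ j *\<^sub>R Y n j (t - \<tau> $ j)) \<in> Lq_on q UNIV" for j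
      using Lq_on_scaleR[OF Lq_on_shift[OF Suc[of j], of "- (\<tau> $ j)"]] by simp
    then have "(\<lambda>t. \<Sum>j\<in>UNIV. K $ i $ j * Y n j (t - \<tau> $ j)) \<in> Lq_on q UNIV"
      by (intro Lq_on_sum \<open>0 \<le> q\<close>) simp
    from Lq_on_restrict[OF this, of "{0..T}"] show ?case
      unfolding Y_Suc step_def by (intro Lq_on_add \<open>0 \<le> q\<close> \<phi>') auto
  qed
  \<comment> \<open>Each round reads the previous iterate only at times at most t - h, so agreement
    of successive iterates spreads by h. Once N h > T, \<open>Y N\<close> is fixed up to T.\<close>
  have stable: "\<forall>i t. t < real n * h \<longrightarrow> Y (Suc n) i t = Y n i t" for n
  proof (induction n)
    case 0
    then show ?case
      by (simp add: Y_def step_def)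
  next
    case (Suc n)
    show ?case
    proof (intro allI impI)
      fix i t assume t: "t < real (Suc n) * h"
      have "Y (Suc n) j (t - \<tau> $ j) = Y n j (t - \<tau> $ j)" for j
        using Suc t h(2)[of j] by (auto simp: algebra_simps)
      then show "Y (Suc (Suc n)) i t = Y (Suc n) i t"
        unfolding Y_Suc[of "Suc n"] Y_Suc[of n] step_def by (simp add: Y_Suc[symmetric])
    qed
  qed
  obtain N :: nat where N: "T < real N * h"
    using reals_Archimedean3[OF h(1)] by blast
  show thesis
  proof (rule that[of "Y N"])
    show "is_solution \<tau> K B T (\<lambda>_. 0) (Y N)"
      unfolding is_solution_iff
    proof (intro ballI allI)
      fix t i assume t: "t \<in> {0..T}"
      then have "Y N i t = step (Y N) i t"
        using stable[of N] N by (auto simp: Y_Suc)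
      then show "Y N i t = (\<Sum>j\<in>UNIV. K $ i $ j * Y N j (t - \<tau> $ j)) + (B *v 0) $ i"
        using t by (simp add: step_def \<phi>'_def)
    qed
    show "has_initial \<tau> \<phi> (Y N)"
      unfolding has_initial_def
    proof (intro allI ballI)
      fix i s assume s: "s \<in> {- (\<tau> $ i)..<0}"
      then show "Y N i s = \<phi> i s"
        by (cases N) (simp_all add: Y_def step_def \<phi>'_def)
    qed
    show "segment (Y N) T \<in> Sigma_fun \<tau> q"
      unfolding Sigma_fun_def segment_def
    proof (intro CollectI allI)
      fix i
      from Lq_on_shift[OF Y, of N i T] have "(\<lambda>s. Y N i (T + s)) \<in> Lq_on q UNIV"
        by (simp add: add.commute)
      then show "(\<lambda>s. Y N i (T + s)) \<in> Lq_on q {- (\<tau> $ i)<..<0}"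
        by (rule Lq_on_subset) auto
    qed
  qed
qed

text \<open>Superposition: to the free solution is added the response to a control that reproduces,
  at horizon T, the state reached from the origin at T'.\<close>

lemma steer:
  fixes K :: "real^'n^'n" and B :: "real^'m^'n"
  assumes "0 \<le> q" "0 < T'" "T_star \<tau> \<le> T"
    and u: "u \<in> Lq_on q {0..T'}"
    and y: "is_solution \<tau> K B T' u y" "has_initial \<tau> (\<lambda>i s. 0) y"
    and z: "is_solution \<tau> K B T (\<lambda>_. 0) z" "has_initial \<tau> \<phi> z"
  obtains v Y where "v \<in> Lq_on q {0..T}" "is_solution \<tau> K B T v Y" "has_initial \<tau> \<phi> Y"
    "\<And>i s. s \<in> {- (\<tau> $ i)<..<0} \<Longrightarrow> segment Y T i s = segment z T i s + segment y T' i s"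
proof -
  \<comment> \<open>A horizon T' \<le> T is prolonged directly; a longer one is first shortened to
    T_* and then prolonged to T.\<close>
  have "\<exists>v\<in>Lq_on q {0..T}. \<forall>i. \<forall>t\<in>{- (\<tau> $ i)..0}.
      endpoint \<tau> K B T v i t = endpoint \<tau> K B T' u i t"
  proof (cases "T' \<le> T")
    case True
    obtain v where "v \<in> Lq_on q {0..T}"
      "\<And>i t. t \<le> 0 \<Longrightarrow> endpoint \<tau> K B T v i t = endpoint \<tau> K B T' u i t"
      using endpoint_prolong[OF True u, of K B] by blast
    then show ?thesis
      by (intro bexI[of _ v]) auto
  next
    case False
    then obtain w where w: "w \<in> Lq_on q {0..T_star \<tau>}"
      "\<And>i t. t \<in> {- (\<tau> $ i)..0} \<Longrightarrow> endpoint \<tau> K B T' u i t = endpoint \<tau> K B (T_star \<tau>) w i t"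
      using endpoint_shorten[OF assms(1) _ u, of K B] assms(3) by auto
    obtain v where "v \<in> Lq_on q {0..T}"
      "\<And>i t. t \<le> 0 \<Longrightarrow> endpoint \<tau> K B T v i t = endpoint \<tau> K B (T_star \<tau>) w i t"
      using endpoint_prolong[OF assms(3) w(1), of K B] by blast
    with w(2) show ?thesis
      by (intro bexI[of _ v]) auto
  qed
  then obtain v where v: "v \<in> Lq_on q {0..T}"
    "\<And>i t. t \<in> {- (\<tau> $ i)..0} \<Longrightarrow> endpoint \<tau> K B T v i t = endpoint \<tau> K B T' u i t"
    by blast
  define Y where "Y i t = z i t + response \<tau> K B v t $ i" for i t
  show thesis
  proof (rule that[OF v(1), of Y])
    show "is_solution \<tau> K B T v Y"
      using z(1) is_solution_response[of K B T v]
      by (simp add: is_solution_iff Y_def sum.distrib distrib_left)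
    show "has_initial \<tau> \<phi> Y"
      using z(2) by (simp add: has_initial_def Y_def response_neg)
    fix i s assume s: "s \<in> {- (\<tau> $ i)<..<0}"
    have "y i (T' + s) = response \<tau> K B u (T' + s) $ i"
      using y s \<open>0 < T'\<close> by (intro solution_eq_response[of K B T']) (auto simp: has_initial_def)
    then show "segment Y T i s = segment z T i s + segment y T' i s"
      using v(2)[of s i] s by (simp add: segment_def Y_def endpoint_eq_response)
  qed
qed

end

subsection \<open>Range and controllability\<close>

lemma Sigma_fun_cong:
  assumes "\<And>i s. s \<in> {- (\<tau> $ i)<..<0} \<Longrightarrow> x i s = y i s"
  shows "x \<in> Sigma_fun \<tau> q \<longleftrightarrow> y \<in> Sigma_fun \<tau> q"
proof -
  have "x i \<in> Lq_on q {- (\<tau> $ i)<..<0} \<longleftrightarrow> y i \<in> Lq_on q {- (\<tau> $ i)<..<0}" for i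
    by (rule Lq_on_cong) (rule assms)
  then show ?thesis
    by (simp add: Sigma_fun_def)
qed

lemma Sigma_eq_cong:
  assumes "\<And>i s. s \<in> {- (\<tau> $ i)<..<0} \<Longrightarrow> x i s = y i s"
  shows "Sigma_eq \<tau> x w \<longleftrightarrow> Sigma_eq \<tau> y w"
  unfolding Sigma_eq_def using assms by (intro all_cong1 AE_cong) simp

lemma Sigma_norm_cong:
  assumes "\<And>i s. s \<in> {- (\<tau> $ i)<..<0} \<Longrightarrow> x i s = y i s"
  shows "Sigma_norm \<tau> q x = Sigma_norm \<tau> q y"
proof -
  have "Lq_norm_on q {- (\<tau> $ i)<..<0} (x i) = Lq_norm_on q {- (\<tau> $ i)<..<0} (y i)" for i
    unfolding Lq_norm_on_def
    by (intro arg_cong[where f = "\<lambda>I. I powr _"] Bochner_Integration.integral_cong refl) (simp add: assms)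
  then show ?thesis
    by (simp add: Sigma_norm_def)
qed

lemma Sigma_rel_Image_cong:
  assumes "\<And>i s. s \<in> {- (\<tau> $ i)<..<0} \<Longrightarrow> x i s = y i s"
  shows "Sigma_rel \<tau> q `` {x} = Sigma_rel \<tau> q `` {y}"
  using Sigma_fun_cong[of \<tau> x y, OF assms] Sigma_eq_cong[of \<tau> x y, OF assms] by (auto simp: Sigma_rel_def)

lemma Sigma_fun_diff:
  assumes "0 \<le> q" "x \<in> Sigma_fun \<tau> q" "y \<in> Sigma_fun \<tau> q"
  shows "(\<lambda>i s. x i s - y i s) \<in> Sigma_fun \<tau> q"
  using assms by (auto simp: Sigma_fun_def intro: Lq_on_diff)

text \<open>Shortening and prolonging give the two inclusions; both produce pointwise equal
  endpoints, hence equal classes.\<close>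

lemma (in delays) Ran_endpoint_eq:
  fixes K :: "real^'n^'n" and B :: "real^'m^'n"
  assumes "0 \<le> q" "T_star \<tau> \<le> T"
  shows "Ran_endpoint \<tau> K B q T = Ran_endpoint \<tau> K B q (T_star \<tau>)"
proof -
  have sub: "Ran_endpoint \<tau> K B q T1 \<subseteq> Ran_endpoint \<tau> K B q T2"
    if "\<And>u. u \<in> Lq_on q {0..T1} \<Longrightarrow> \<exists>v\<in>Lq_on q {0..T2}. \<forall>i. \<forall>t\<in>{- (\<tau> $ i)<..<0}.
      endpoint \<tau> K B T1 u i t = endpoint \<tau> K B T2 v i t" for T1 T2
  proof
    fix X assume "X \<in> Ran_endpoint \<tau> K B q T1"
    then obtain u where u: "u \<in> Lq_on q {0..T1}" "X = Sigma_rel \<tau> q `` {endpoint \<tau> K B T1 u}"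
      by (auto simp: Ran_endpoint_def)
    from that[OF u(1)] obtain v where v: "v \<in> Lq_on q {0..T2}"
      "\<And>i t. t \<in> {- (\<tau> $ i)<..<0} \<Longrightarrow> endpoint \<tau> K B T1 u i t = endpoint \<tau> K B T2 v i t"
      by blast
    have "X = Sigma_rel \<tau> q `` {endpoint \<tau> K B T2 v}"
      unfolding u(2) by (rule Sigma_rel_Image_cong) (rule v(2))
    with v(1) show "X \<in> Ran_endpoint \<tau> K B q T2"
      by (auto simp: Ran_endpoint_def)
  qed
  show ?thesis
  proof (intro equalityI sub)
    fix u :: "real \<Rightarrow> real^'m" assume "u \<in> Lq_on q {0..T}"
    from endpoint_shorten[OF assms this, of K B] obtain v where "v \<in> Lq_on q {0..T_star \<tau>}"
      "\<And>i t. t \<in> {- (\<tau> $ i)..0} \<Longrightarrow> endpoint \<tau> K B T u i t = endpoint \<tau> K B (T_star \<tau>) v i t"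
      by blast
    then show "\<exists>v\<in>Lq_on q {0..T_star \<tau>}. \<forall>i. \<forall>t\<in>{- (\<tau> $ i)<..<0}.
        endpoint \<tau> K B T u i t = endpoint \<tau> K B (T_star \<tau>) v i t"
      by (intro bexI[of _ v]) auto
  next
    fix u :: "real \<Rightarrow> real^'m" assume "u \<in> Lq_on q {0..T_star \<tau>}"
    from endpoint_prolong[OF assms(2) this, of K B] obtain v where "v \<in> Lq_on q {0..T}"
      "\<And>i t. t \<le> 0 \<Longrightarrow> endpoint \<tau> K B T v i t = endpoint \<tau> K B (T_star \<tau>) u i t"
      by blast
    then show "\<exists>v\<in>Lq_on q {0..T}. \<forall>i. \<forall>t\<in>{- (\<tau> $ i)<..<0}.
        endpoint \<tau> K B (T_star \<tau>) u i t = endpoint \<tau> K B T v i t"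
      by (intro bexI[of _ v]) auto
  qed
qed

text \<open>The final state of the free evolution of \<phi> is subtracted from the target, which is
  then approached from the origin; \<open>steer\<close> moves the control to horizon T. The converse
  takes T = T_* > 0 and \<phi> = 0.\<close>

lemma (in delays) approx_controllable_iff:
  fixes K :: "real^'n^'n" and B :: "real^'m^'n"
  assumes "0 \<le> q"
  shows "approx_controllable_from_origin \<tau> K B q \<longleftrightarrow>
    (\<forall>T\<ge>T_star \<tau>. approx_controllable_in_time \<tau> K B q T)" (is "?L \<longleftrightarrow> ?R")
proof
  assume L: ?L
  show ?R
    unfolding approx_controllable_in_time_def
  proof (intro allI impI ballI)
    fix T \<epsilon> \<phi> \<psi>
    assume T: "T_star \<tau> \<le> T" and \<epsilon>: "(0::real) < \<epsilon>"
      and \<phi>: "\<phi> \<in> Sigma_fun \<tau> q" and \<psi>: "\<psi> \<in> Sigma_fun \<tau> q"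
    obtain z where z: "is_solution \<tau> K B T (\<lambda>_. 0) z" "has_initial \<tau> \<phi> z"
        "segment z T \<in> Sigma_fun \<tau> q"
      using free_solution[OF assms \<phi>, of K B T] by blast
    obtain T' u y where "0 < T'" and u: "u \<in> Lq_on q {0..T'}"
      and y: "is_solution \<tau> K B T' u y" "has_initial \<tau> (\<lambda>i s. 0) y"
      and dist: "Sigma_norm \<tau> q (\<lambda>i s. segment y T' i s - (\<psi> i s - segment z T i s)) < \<epsilon>"
      using L[unfolded approx_controllable_from_origin_def, rule_format,
          OF \<epsilon> Sigma_fun_diff[OF assms \<psi> z(3)]] by blast
    obtain v Y where v: "v \<in> Lq_on q {0..T}" "is_solution \<tau> K B T v Y" "has_initial \<tau> \<phi> Y"
      and Y: "\<And>i s. s \<in> {- (\<tau> $ i)<..<0} \<Longrightarrow> segment Y T i s = segment z T i s + segment y T' i s"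
      using steer[OF assms \<open>0 < T'\<close> T u y z(1,2)] by blast
    have "Sigma_norm \<tau> q (\<lambda>i s. segment Y T i s - \<psi> i s) =
        Sigma_norm \<tau> q (\<lambda>i s. segment y T' i s - (\<psi> i s - segment z T i s))"
      by (rule Sigma_norm_cong) (simp add: Y)
    with v dist show "\<exists>u\<in>Lq_on q {0..T}. \<exists>y. is_solution \<tau> K B T u y \<and> has_initial \<tau> \<phi> y \<and>
        Sigma_norm \<tau> q (\<lambda>i s. segment y T i s - \<psi> i s) < \<epsilon>"
      by (intro bexI[of _ v] exI[of _ Y]) simp_all
  qed
next
  assume ?R
  then have "approx_controllable_in_time \<tau> K B q (T_star \<tau>)"
    by simp
  moreover have "(\<lambda>i s. 0) \<in> Sigma_fun \<tau> q"
    by (simp add: Sigma_fun_def Lq_on_zero)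
  ultimately show ?L
    unfolding approx_controllable_in_time_def approx_controllable_from_origin_def
    using T_star_pos by blast
qed

text \<open>The same reduction as in the approximate case, with almost everywhere equality in place
  of the distance.\<close>

lemma (in delays) exact_controllable_iff:
  fixes K :: "real^'n^'n" and B :: "real^'m^'n"
  assumes "0 \<le> q"
  shows "exact_controllable_from_origin \<tau> K B q \<longleftrightarrow>
    (\<forall>T\<ge>T_star \<tau>. exact_controllable_in_time \<tau> K B q T)" (is "?L \<longleftrightarrow> ?R")
proof
  assume L: ?L
  show ?R
    unfolding exact_controllable_in_time_def
  proof (intro allI impI ballI)
    fix T \<phi> \<psi>
    assume T: "T_star \<tau> \<le> T" and \<phi>: "\<phi> \<in> Sigma_fun \<tau> q" and \<psi>: "\<psi> \<in> Sigma_fun \<tau> q"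
    obtain z where z: "is_solution \<tau> K B T (\<lambda>_. 0) z" "has_initial \<tau> \<phi> z"
        "segment z T \<in> Sigma_fun \<tau> q"
      using free_solution[OF assms \<phi>, of K B T] by blast
    obtain T' u y where "0 < T'" and u: "u \<in> Lq_on q {0..T'}"
      and y: "is_solution \<tau> K B T' u y" "has_initial \<tau> (\<lambda>i s. 0) y"
      and eq: "Sigma_eq \<tau> (segment y T') (\<lambda>i s. \<psi> i s - segment z T i s)"
      using L[unfolded exact_controllable_from_origin_def, rule_format,
          OF Sigma_fun_diff[OF assms \<psi> z(3)]] by blast
    obtain v Y where v: "v \<in> Lq_on q {0..T}" "is_solution \<tau> K B T v Y" "has_initial \<tau> \<phi> Y"
      and Y: "\<And>i s. s \<in> {- (\<tau> $ i)<..<0} \<Longrightarrow> segment Y T i s = segment z T i s + segment y T' i s"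
      using steer[OF assms \<open>0 < T'\<close> T u y z(1,2)] by blast
    have "Sigma_eq \<tau> (\<lambda>i s. segment z T i s + segment y T' i s) \<psi>"
      unfolding Sigma_eq_def
    proof
      fix i
      from eq have "AE s in lebesgue_on {- (\<tau> $ i)<..<0}.
          segment y T' i s = \<psi> i s - segment z T i s"
        by (simp add: Sigma_eq_def)
      then show "AE s in lebesgue_on {- (\<tau> $ i)<..<0}.
          segment z T i s + segment y T' i s = \<psi> i s"
        by eventually_elim simp
    qed
    then have "Sigma_eq \<tau> (segment Y T) \<psi>"
      using Sigma_eq_cong[of \<tau> "segment Y T", OF Y] by blast
    with v show "\<exists>u\<in>Lq_on q {0..T}. \<exists>y. is_solution \<tau> K B T u y \<and> has_initial \<tau> \<phi> y \<and>
        Sigma_eq \<tau> (segment y T) \<psi>"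
      by blast
  qed
next
  assume ?R
  then have "exact_controllable_in_time \<tau> K B q (T_star \<tau>)"
    by simp
  moreover have "(\<lambda>i s. 0) \<in> Sigma_fun \<tau> q"
    by (simp add: Sigma_fun_def Lq_on_zero)
  ultimately show ?L
    unfolding exact_controllable_in_time_def exact_controllable_from_origin_def
    using T_star_pos by blast
qed

theorem theorem4p1:
  fixes \<tau> :: "real^'n" and K :: "real^'n^'n" and B :: "real^'m^'n" and q :: real
  assumes "\<forall>i. 0 < \<tau> $ i" and "1 \<le> q"
  shows "(\<forall>T\<ge>T_star \<tau>. Ran_endpoint \<tau> K B q T = Ran_endpoint \<tau> K B q (T_star \<tau>)) \<and>
         (approx_controllable_from_origin \<tau> K B q \<longleftrightarrow>
            (\<forall>T\<ge>T_star \<tau>. approx_controllable_in_time \<tau> K B q T)) \<and>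
         (exact_controllable_from_origin \<tau> K B q \<longleftrightarrow>
            (\<forall>T\<ge>T_star \<tau>. exact_controllable_in_time \<tau> K B q T))"
proof -
  interpret delays \<tau>
    by unfold_locales (use assms(1) in blast)
  from assms(2) have "0 \<le> q"
    by simp
  then show ?thesis
    using Ran_endpoint_eq approx_controllable_iff exact_controllable_iff by blast
qed

end
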